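(* The sum of the cosines of all pairwise angles between $N$ lines in $\mathbb{R}^d$ is at least $N-d$. For $N\in[d,2d]$, this bound is sharp, and the unique minimizer (up to orthogonal transformations of $\mathbb{R}^d$ and reordering of the lines) is the set of $N$ lines forming a repeated orthonormal basis.
   Context: Lines are taken through the origin of $\mathbb{R}^d$, and repetitions are allowed (the $N$ lines form a multiset). The angle between two lines is understood to lie in $[0,\pi/2]$, so if the lines are spanned by unit vectors $x_i$ and $x_j$, the cosine of the angle between them is $|\langle x_i,x_j\rangle|$. The sum is over all unordered pairs $\{i,j\}$, $i\neq j$. The $N$ lines form a repeated orthonormal basis if, for some orthonormal basis $e_1,\ldots,e_d$ of $\mathbb{R}^d$, after reordering, the $j$-th line is spanned by $e_{j \bmod d}$ for $j=1,\ldots,N$ (indices taken modulo $d$ in $\{1,\ldots,d\}$); for $d\le N\le 2d$ this means that each line $\mathbb{R}e_i$ occurs once or twice, with exactly $N-d$ of them occurring twice. *)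

theory Defs
  imports "HOL-Analysis.Analysis" "HOL-Combinatorics.Permutations"
begin

definition is_line :: "'a::euclidean_space set \<Rightarrow> bool" where
  "is_line l \<longleftrightarrow> subspace l \<and> dim l = 1"

(* The unit vectors of a line are determined up to sign, so the condition on \<theta> does not depend
   on their choice and determines \<theta>. *)
definition line_angle :: "'a::euclidean_space set \<Rightarrow> 'a set \<Rightarrow> real" where
  "line_angle l m = (THE \<theta>. 0 \<le> \<theta> \<and> \<theta> \<le> pi / 2 \<and>
     (\<forall>x\<in>l. \<forall>y\<in>m. norm x = 1 \<and> norm y = 1 \<longrightarrow> cos \<theta> = \<bar>x \<bullet> y\<bar>))"

lemma cos_line_angle_span:
  fixes x y :: "'a::euclidean_space"
  assumes "norm x = 1" "norm y = 1"
  shows "cos (line_angle (span {x}) (span {y})) = \<bar>x \<bullet> y\<bar>"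
proof -
  have le1: "\<bar>x \<bullet> y\<bar> \<le> 1"
    using Cauchy_Schwarz_ineq2[of x y] assms by simp
  have all: "\<bar>u \<bullet> v\<bar> = \<bar>x \<bullet> y\<bar>"
    if uv: "u \<in> span {x}" "v \<in> span {y}" "norm u = 1" "norm v = 1" for u v
  proof -
    obtain a b where "u = a *\<^sub>R x" "v = b *\<^sub>R y"
      using uv(1,2) unfolding span_singleton by blast
    then show ?thesis
      using uv assms by (simp add: abs_mult)
  qed
  have "line_angle (span {x}) (span {y}) = arccos \<bar>x \<bullet> y\<bar>"
    unfolding line_angle_def
  proof (rule the_equality, intro conjI ballI impI)
    show "0 \<le> arccos \<bar>x \<bullet> y\<bar>" "arccos \<bar>x \<bullet> y\<bar> \<le> pi / 2"
      using le1 arccos_lbound[of "\<bar>x \<bullet> y\<bar>"] arccos_le_pi2[of "\<bar>x \<bullet> y\<bar>"] by auto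
  next
    fix u v
    assume "u \<in> span {x}" "v \<in> span {y}" "norm u = 1 \<and> norm v = 1"
    then show "cos (arccos \<bar>x \<bullet> y\<bar>) = \<bar>u \<bullet> v\<bar>"
      using all[of u v] le1 by simp
  next
    fix t
    assume t: "0 \<le> t \<and> t \<le> pi / 2 \<and> (\<forall>u\<in>span {x}. \<forall>v\<in>span {y}.
      norm u = 1 \<and> norm v = 1 \<longrightarrow> cos t = \<bar>u \<bullet> v\<bar>)"
    then have "cos t = \<bar>x \<bullet> y\<bar>"
      using assms by (simp add: span_base)
    then show "t = arccos \<bar>x \<bullet> y\<bar>"
      using t arccos_cos[of t] by simp
  qed
  then show ?thesis
    using le1 by simp
qed

(* A multiset of N lines is given as a family indexed by {..<N}; values at indices \<ge> N are
   irrelevant in everything below. *)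
definition line_family :: "nat \<Rightarrow> (nat \<Rightarrow> 'a::euclidean_space set) \<Rightarrow> bool" where
  "line_family N L \<longleftrightarrow> (\<forall>j<N. is_line (L j))"

definition cos_angle_sum :: "nat \<Rightarrow> (nat \<Rightarrow> 'a::euclidean_space set) \<Rightarrow> real" where
  "cos_angle_sum N L = (\<Sum>j<N. \<Sum>i<j. cos (line_angle (L i) (L j)))"

definition orthonormal_basis :: "(nat \<Rightarrow> 'a::euclidean_space) \<Rightarrow> bool" where
  "orthonormal_basis e \<longleftrightarrow>
     (\<forall>i<DIM('a). \<forall>j<DIM('a). e i \<bullet> e j = (if i = j then 1 else 0)) \<and>
     span (e ` {..<DIM('a)}) = UNIV"

definition repeated_orthonormal_basis ::
    "nat \<Rightarrow> (nat \<Rightarrow> 'a::euclidean_space set) \<Rightarrow> bool" where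
  "repeated_orthonormal_basis N L \<longleftrightarrow>
     (\<exists>e p. orthonormal_basis e \<and> p permutes {..<N} \<and>
        (\<forall>j<N. L (p j) = span {e (j mod DIM('a))}))"

definition same_up_to_orthogonal ::
    "nat \<Rightarrow> (nat \<Rightarrow> 'a::euclidean_space set) \<Rightarrow> (nat \<Rightarrow> 'a set) \<Rightarrow> bool" where
  "same_up_to_orthogonal N L M \<longleftrightarrow>
     (\<exists>f p. orthogonal_transformation f \<and> p permutes {..<N} \<and> (\<forall>j<N. M (p j) = f ` L j))"

end

theory Submission
  imports Defs
begin

text \<open>
  Let \<open>x\<^sub>1, \<dots>, x\<^sub>N\<close> be unit vectors spanning the lines in dimension \<open>d\<close>, with Gram matrix \<open>G\<close>, and
  let \<open>Q\<close> be the orthogonal projection of \<open>\<real>\<^sup>N\<close> onto the row space of the \<open>d \<times> N\<close> matrix with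
  columns \<open>x\<^sub>i\<close>. The rows of \<open>G\<close> lie in that space, so \<open>Q G = G\<close>, and comparing traces gives
  \<open>N = tr G = tr (Q G) = tr Q + 2 * \<Sum>\<^sub>i\<^sub><\<^sub>j Q\<^sub>i\<^sub>j G\<^sub>i\<^sub>j\<close>. The trace of \<open>Q\<close> is its rank, hence at most
  \<open>d\<close>. An off-diagonal entry of an orthogonal projection is at most \<open>1/2\<close> in absolute value, because
  \<open>Q\<^sub>i\<^sub>i = \<Sum>\<^sub>j Q\<^sub>i\<^sub>j\<^sup>2\<close> gives \<open>Q\<^sub>i\<^sub>j\<^sup>2 \<le> Q\<^sub>i\<^sub>i (1 - Q\<^sub>i\<^sub>i) \<le> 1/4\<close>. Therefore
  \<open>N - d \<le> \<Sum>\<^sub>i\<^sub><\<^sub>j \<bar>G\<^sub>i\<^sub>j\<bar>\<close>, which is the sum of the cosines (\<open>abs_inner_sum_bound\<close>).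

  If equality holds, then \<open>\<bar>Q\<^sub>i\<^sub>j\<bar> = 1/2\<close> whenever \<open>i \<noteq> j\<close> and \<open>G\<^sub>i\<^sub>j \<noteq> 0\<close>. Equality in the estimate of
  \<open>Q\<^sub>i\<^sub>j\<close> forces \<open>Q\<^sub>i\<^sub>i = 1/2\<close> and all other entries of row \<open>i\<close> to vanish, so \<open>x\<^sub>i = \<plusminus>x\<^sub>j\<close> and all the
  other vectors are orthogonal to \<open>x\<^sub>i\<close>. The lines therefore coincide in pairs or are orthogonal, each
  pair counts one in the sum, and so there are \<open>N - d\<close> pairs and \<open>d\<close> different lines
  (\<open>repeated_orthonormal_basis_of_cos_angle_sum_eq\<close>). Conversely, for \<open>d \<le> N \<le> 2 d\<close> a repeated
  orthonormal basis has \<open>N - d\<close> coinciding pairs and attains the bound. Any two of these families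
  differ by the orthogonal transformation that carries one basis to the other.
\<close>

section \<open>Orthogonal projection matrices\<close>

definition projection_matrix :: "'i set \<Rightarrow> ('i \<Rightarrow> 'i \<Rightarrow> real) \<Rightarrow> bool" where
  "projection_matrix I Q \<longleftrightarrow>
     (\<forall>i\<in>I. \<forall>j\<in>I. Q i j = Q j i) \<and>
     (\<forall>i\<in>I. \<forall>k\<in>I. (\<Sum>j\<in>I. Q i j * Q j k) = Q i k)"

text \<open>
  The row space of the matrix with rows \<open>v b\<close> has dimension at most \<open>card B\<close>, and \<open>Q\<close> is the
  orthogonal projection onto it. It is built by Gram--Schmidt, one row at a time: the part \<open>w\<close> of the
  new row that is orthogonal to the image of \<open>Q\<close> contributes the rank-one projection
  \<open>w w\<^sup>T / \<parallel>w\<parallel>\<^sup>2\<close>, of trace one.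
\<close>

lemma exists_projection_matrix_fixing:
  fixes v :: "'b \<Rightarrow> 'i \<Rightarrow> real"
  assumes "finite I" "finite B"
  shows "\<exists>Q. projection_matrix I Q \<and> (\<Sum>i\<in>I. Q i i) \<le> real (card B) \<and>
             (\<forall>b\<in>B. \<forall>i\<in>I. (\<Sum>j\<in>I. Q i j * v b j) = v b i)"
  using \<open>finite B\<close>
proof induction
  case empty
  show ?case
    by (rule exI[of _ "\<lambda>_ _. 0"]) (simp add: projection_matrix_def)
next
  case (insert b B)
  then obtain Q where
    sym: "\<And>i j. i \<in> I \<Longrightarrow> j \<in> I \<Longrightarrow> Q i j = Q j i" and
    idem: "\<And>i k. i \<in> I \<Longrightarrow> k \<in> I \<Longrightarrow> (\<Sum>j\<in>I. Q i j * Q j k) = Q i k" and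
    tr: "(\<Sum>i\<in>I. Q i i) \<le> real (card B)" and
    fix_B: "\<And>c i. c \<in> B \<Longrightarrow> i \<in> I \<Longrightarrow> (\<Sum>j\<in>I. Q i j * v c j) = v c i"
    unfolding projection_matrix_def by blast
  \<comment> \<open>The component of the new row orthogonal to the image of \<open>Q\<close>, and its squared norm.\<close>
  define w where "w i = v b i - (\<Sum>j\<in>I. Q i j * v b j)" for i
  define s where "s = (\<Sum>i\<in>I. w i * w i)"
  have Qw: "(\<Sum>j\<in>I. Q i j * w j) = 0" if "i \<in> I" for i
  proof -
    have "(\<Sum>j\<in>I. Q i j * (\<Sum>k\<in>I. Q j k * v b k)) = (\<Sum>k\<in>I. \<Sum>j\<in>I. Q i j * Q j k * v b k)"
      by (subst sum.swap) (simp add: sum_distrib_left mult.assoc)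
    also have "\<dots> = (\<Sum>k\<in>I. Q i k * v b k)"
      by (simp add: sum_distrib_right[symmetric] idem that)
    finally show ?thesis
      by (simp add: w_def right_diff_distrib sum_subtractf)
  qed
  \<comment> \<open>Hence \<open>w\<close> is orthogonal to every row fixed by \<open>Q\<close>, in particular to the earlier ones.\<close>
  have w_orth: "(\<Sum>j\<in>I. w j * (\<Sum>k\<in>I. Q j k * u k)) = 0" for u
  proof -
    have "(\<Sum>j\<in>I. w j * (\<Sum>k\<in>I. Q j k * u k)) = (\<Sum>k\<in>I. u k * (\<Sum>j\<in>I. Q k j * w j))"
      unfolding sum_distrib_left
      by (subst sum.swap) (auto intro!: sum.cong simp: sym mult_ac)
    then show ?thesis
      by (simp add: Qw)
  qed
  show ?case
  proof (cases "s = 0")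
    case True
    then have "w i = 0" if "i \<in> I" for i
      using that \<open>finite I\<close> by (simp add: s_def sum_nonneg_eq_0_iff)
    then have "\<forall>c\<in>insert b B. \<forall>i\<in>I. (\<Sum>j\<in>I. Q i j * v c j) = v c i"
      using fix_B by (auto simp: w_def)
    moreover have "card B \<le> card (insert b B)"
      using insert by simp
    ultimately show ?thesis
      using sym idem tr unfolding projection_matrix_def
      by (intro exI[of _ Q]) (auto intro: order_trans)
  next
    case False
    define Q' where "Q' i j = Q i j + w i * w j / s" for i j
    have apply_Q': "(\<Sum>j\<in>I. Q' i j * u j) = (\<Sum>j\<in>I. Q i j * u j) + w i / s * (\<Sum>j\<in>I. w j * u j)" for i u
      by (simp add: Q'_def algebra_simps sum.distrib sum_distrib_left)
    have "(\<Sum>j\<in>I. Q' i j * Q' j k) = Q' i k" if "i \<in> I" "k \<in> I" for i k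
    proof -
      have "(\<Sum>j\<in>I. Q i j * Q' j k) = Q i k"
      proof -
        have "(\<Sum>j\<in>I. Q i j * Q' j k) = (\<Sum>j\<in>I. Q i j * Q j k) + (\<Sum>j\<in>I. Q i j * w j) * (w k / s)"
          by (simp add: Q'_def algebra_simps sum.distrib sum_distrib_left)
        then show ?thesis
          using that by (simp add: idem Qw)
      qed
      moreover have "(\<Sum>j\<in>I. w j * Q' j k) = w k"
      proof -
        have "(\<Sum>j\<in>I. w j * Q' j k) = (\<Sum>j\<in>I. Q k j * w j) + s * (w k / s)"
          using that by (simp add: Q'_def s_def algebra_simps sum.distrib sum_distrib_left sum_divide_distrib sym[of k])
        then show ?thesis
          using that False by (simp add: Qw)
      qed
      ultimately show ?thesis
        by (simp add: apply_Q') (simp add: Q'_def)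
    qed
    moreover have "Q' i j = Q' j i" if "i \<in> I" "j \<in> I" for i j
      using that sym by (simp add: Q'_def mult.commute)
    moreover have "(\<Sum>i\<in>I. Q' i i) \<le> card (insert b B)"
    proof -
      have "(\<Sum>i\<in>I. Q' i i) = (\<Sum>i\<in>I. Q i i) + s / s"
        by (simp add: Q'_def s_def sum.distrib flip: sum_divide_distrib)
      then show ?thesis
        using tr insert False by simp
    qed
    moreover have "(\<Sum>j\<in>I. Q' i j * v c j) = v c i" if c: "c \<in> insert b B" and i: "i \<in> I" for c i
    proof (cases "c \<in> B")
      case True
      then have "(\<Sum>j\<in>I. w j * v c j) = 0"
        using w_orth[of "v c"] by (simp add: fix_B)
      then show ?thesis
        using True i by (simp add: apply_Q' fix_B)
    next
      case False
      then have [simp]: "c = b"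
        using c by simp
      have "(\<Sum>j\<in>I. w j * v b j) = s + (\<Sum>j\<in>I. w j * (\<Sum>k\<in>I. Q j k * v b k))"
        unfolding s_def sum.distrib[symmetric] by (intro sum.cong) (simp_all add: w_def algebra_simps)
      then show ?thesis
        using \<open>s \<noteq> 0\<close> by (simp add: apply_Q' w_orth) (simp add: w_def)
    qed
    ultimately show ?thesis
      unfolding projection_matrix_def by (intro exI[of _ Q']) blast
  qed
qed

text \<open>
  By symmetry and idempotence, \<open>Q i i\<close> is the sum of squares of row \<open>i\<close>. Moving the diagonal term
  to the other side and completing the square makes the right-hand side a constant.
\<close>

lemma projection_matrix_offdiag:
  assumes "finite I" "projection_matrix I Q" "i \<in> I" "J \<subseteq> I - {i}"
  shows "(Q i i - 1/2)\<^sup>2 + (\<Sum>j\<in>J. (Q i j)\<^sup>2) \<le> 1/4"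
proof -
  have "Q i i = (\<Sum>j\<in>I. Q i j * Q j i)"
    using assms(2,3) unfolding projection_matrix_def by metis
  also have "\<dots> = (\<Sum>j\<in>I. (Q i j)\<^sup>2)"
    using assms(2,3) unfolding projection_matrix_def by (auto intro!: sum.cong simp: power2_eq_square)
  also have "\<dots> = (Q i i)\<^sup>2 + (\<Sum>j\<in>I - {i}. (Q i j)\<^sup>2)"
    using assms(1,3) by (rule sum.remove)
  finally have "(Q i i)\<^sup>2 + (\<Sum>j\<in>I - {i}. (Q i j)\<^sup>2) = Q i i"
    by simp
  moreover have "(\<Sum>j\<in>J. (Q i j)\<^sup>2) \<le> (\<Sum>j\<in>I - {i}. (Q i j)\<^sup>2)"
    using assms(1,4) by (intro sum_mono2) auto
  ultimately show ?thesis
    by (simp add: power2_eq_square algebra_simps)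
qed

lemma projection_matrix_abs_offdiag_le_half:
  assumes "finite I" "projection_matrix I Q" "i \<in> I" "j \<in> I" "i \<noteq> j"
  shows "\<bar>Q i j\<bar> \<le> 1/2"
proof -
  have "(Q i i - 1/2)\<^sup>2 + (Q i j)\<^sup>2 \<le> 1/4"
    using projection_matrix_offdiag[OF assms(1-3), of "{j}"] assms(4,5) by simp
  then have "(Q i j)\<^sup>2 \<le> (1/2)\<^sup>2"
    using zero_le_power2[of "Q i i - 1/2"] unfolding power2_eq_square by linarith
  then show ?thesis
    using abs_le_square_iff[of "Q i j" "1/2"] by simp
qed

text \<open>
  An off-diagonal entry of modulus \<open>1/2\<close> already uses up the whole bound of
  \<open>projection_matrix_offdiag\<close>, so every other square in that bound vanishes.
\<close>

lemma projection_matrix_row_of_half: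
  assumes "finite I" "projection_matrix I Q" "i \<in> I" "j \<in> I" "i \<noteq> j" "\<bar>Q i j\<bar> = 1/2"
  shows "Q i i = 1/2" and "\<And>k. k \<in> I \<Longrightarrow> k \<noteq> i \<Longrightarrow> k \<noteq> j \<Longrightarrow> Q i k = 0"
proof -
  have sq: "(Q i j)\<^sup>2 = 1/4"
    using power2_abs[of "Q i j"] assms(6) by (simp add: power2_eq_square)
  have "(Q i i - 1/2)\<^sup>2 \<le> 0"
    using projection_matrix_offdiag[OF assms(1-3), of "{j}"] assms(4,5) sq by simp
  then show "Q i i = 1/2"
    by simp
  fix k assume k: "k \<in> I" "k \<noteq> i" "k \<noteq> j"
  have "(Q i i - 1/2)\<^sup>2 + (Q i k)\<^sup>2 \<le> 0"
    using projection_matrix_offdiag[OF assms(1-3), of "{j, k}"] assms(4,5) k sq by simp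
  then show "Q i k = 0"
    using zero_le_power2[of "Q i i - 1/2"] by (smt (verit) power2_less_eq_zero_iff)
qed

section \<open>The lower bound and its equality case for unit vectors\<close>

lemma sum_symmetric_eq_pairs:
  fixes h :: "nat \<Rightarrow> nat \<Rightarrow> real"
  assumes "\<And>i j. i < N \<Longrightarrow> j < N \<Longrightarrow> h i j = h j i"
  shows "(\<Sum>i<N. \<Sum>j<N. h i j) = (\<Sum>i<N. h i i) + 2 * (\<Sum>j<N. \<Sum>i<j. h i j)"
  using assms
proof (induction N)
  case (Suc N)
  have "(\<Sum>j<N. h N j) = (\<Sum>i<N. h i N)"
    using Suc.prems by (intro sum.cong) auto
  then show ?case
    using Suc by (simp add: sum.distrib)
qed simp

text \<open>
  Here the rows are the \<open>DIM('a)\<close> coordinate sequences of the vectors. Since \<open>Q\<close> fixes each of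
  them, it reproduces the vectors themselves as linear combinations of one another.
\<close>

lemma exists_projection_matrix_of_vectors:
  fixes x :: "'i \<Rightarrow> 'a::euclidean_space"
  assumes "finite I"
  obtains Q where "projection_matrix I Q" "(\<Sum>i\<in>I. Q i i) \<le> DIM('a)"
    "\<And>i. i \<in> I \<Longrightarrow> (\<Sum>j\<in>I. Q i j *\<^sub>R x j) = x i"
proof -
  obtain Q where Q: "projection_matrix I Q" "(\<Sum>i\<in>I. Q i i) \<le> DIM('a)"
    "\<forall>b\<in>Basis. \<forall>i\<in>I. (\<Sum>j\<in>I. Q i j * (x j \<bullet> b)) = x i \<bullet> b"
    using exists_projection_matrix_fixing[OF assms finite_Basis, of "\<lambda>b j. x j \<bullet> b"] by blast
  have "(\<Sum>j\<in>I. Q i j *\<^sub>R x j) = x i" if "i \<in> I" for i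
    by (rule euclidean_eqI) (use Q(3) that in \<open>simp add: inner_sum_left\<close>)
  then show thesis
    using that Q by blast
qed

text \<open>
  Taking the inner product of \<open>\<Sum>j<N. Q i j *\<^sub>R x j = x i\<close> with \<open>x i\<close> and summing over \<open>i\<close> gives
  \<open>N = tr Q + 2 * \<Sum>\<^sub>i\<^sub><\<^sub>j Q i j * (x i \<bullet> x j)\<close>; the bound follows from \<open>tr Q \<le> DIM('a)\<close> and
  \<open>\<bar>Q i j\<bar> \<le> 1/2\<close>.

  In the case of equality, \<open>\<bar>Q i j\<bar> = 1/2\<close> for every non-orthogonal pair. Then row \<open>i\<close> of \<open>Q\<close> has
  just the entries \<open>1/2\<close> and \<open>\<plusminus>1/2\<close> in the columns \<open>i\<close> and \<open>j\<close>, so that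
  \<open>x i = x i / 2 \<plusminus> x j / 2\<close>, and no third vector can be non-orthogonal to \<open>x i\<close>.
\<close>

lemma abs_inner_sum_bound:
  fixes x :: "nat \<Rightarrow> 'a::euclidean_space"
  assumes unit: "\<And>i. i < N \<Longrightarrow> norm (x i) = 1"
  shows "real N - DIM('a) \<le> (\<Sum>j<N. \<Sum>i<j. \<bar>x i \<bullet> x j\<bar>)"
    and "\<lbrakk>(\<Sum>j<N. \<Sum>i<j. \<bar>x i \<bullet> x j\<bar>) = real N - DIM('a); i < N; j < N; i \<noteq> j; x i \<bullet> x j \<noteq> 0\<rbrakk>
      \<Longrightarrow> (x i = x j \<or> x i = - x j) \<and> (\<forall>k<N. k \<noteq> i \<longrightarrow> k \<noteq> j \<longrightarrow> x i \<bullet> x k = 0)"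
proof -
  obtain Q where Q: "projection_matrix {..<N} Q" and tr: "(\<Sum>i<N. Q i i) \<le> DIM('a)"
    and Qx: "\<And>i. i < N \<Longrightarrow> (\<Sum>j<N. Q i j *\<^sub>R x j) = x i"
    using exists_projection_matrix_of_vectors[of "{..<N}" x] by auto
  note half = projection_matrix_abs_offdiag_le_half[OF finite_lessThan Q]
  note row = projection_matrix_row_of_half[OF finite_lessThan Q]
  have sym: "Q i j = Q j i" if "i < N" "j < N" for i j
    using Q that unfolding projection_matrix_def by simp
  have le: "2 * (Q i j * (x i \<bullet> x j)) \<le> \<bar>x i \<bullet> x j\<bar>" if "i < N" "j < N" "i \<noteq> j" for i j
  proof -
    have "2 * (Q i j * (x i \<bullet> x j)) \<le> 2 * (\<bar>Q i j\<bar> * \<bar>x i \<bullet> x j\<bar>)"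
      by (metis abs_ge_self abs_mult mult_le_cancel_left_pos zero_less_numeral)
    also have "\<dots> \<le> 2 * (1/2 * \<bar>x i \<bullet> x j\<bar>)"
      using half[of i j] that by (intro mult_left_mono mult_right_mono) auto
    finally show ?thesis by simp
  qed
  have "real N = (\<Sum>i<N. \<Sum>j<N. Q i j * (x i \<bullet> x j))"
  proof -
    have "(\<Sum>j<N. Q i j * (x i \<bullet> x j)) = 1" if "i < N" for i
    proof -
      have "(\<Sum>j<N. Q i j * (x i \<bullet> x j)) = x i \<bullet> (\<Sum>j<N. Q i j *\<^sub>R x j)"
        by (simp add: inner_sum_right)
      then show ?thesis
        using Qx unit that by (simp add: norm_eq_1)
    qed
    then show ?thesis by simp
  qed
  also have "\<dots> = (\<Sum>i<N. Q i i) + (\<Sum>j<N. \<Sum>i<j. 2 * (Q i j * (x i \<bullet> x j)))"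
    using unit by (subst sum_symmetric_eq_pairs)
      (auto simp: sym inner_commute norm_eq_1 sum_distrib_left)
  finally have lower: "real N - DIM('a) \<le> (\<Sum>j<N. \<Sum>i<j. 2 * (Q i j * (x i \<bullet> x j)))"
    using tr by simp
  have inner_le: "(\<Sum>i<j. 2 * (Q i j * (x i \<bullet> x j))) \<le> (\<Sum>i<j. \<bar>x i \<bullet> x j\<bar>)" if "j < N" for j
    using that by (intro sum_mono le) auto
  then have upper: "(\<Sum>j<N. \<Sum>i<j. 2 * (Q i j * (x i \<bullet> x j))) \<le> (\<Sum>j<N. \<Sum>i<j. \<bar>x i \<bullet> x j\<bar>)"
    by (intro sum_mono[of "{..<N}"]) simp
  show "real N - DIM('a) \<le> (\<Sum>j<N. \<Sum>i<j. \<bar>x i \<bullet> x j\<bar>)"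
    using lower upper by linarith
  assume eq: "(\<Sum>j<N. \<Sum>i<j. \<bar>x i \<bullet> x j\<bar>) = real N - DIM('a)"
    and ij: "i < N" "j < N" "i \<noteq> j" and nz: "x i \<bullet> x j \<noteq> 0"
  have sums_eq: "(\<Sum>j<N. \<Sum>i<j. 2 * (Q i j * (x i \<bullet> x j))) = (\<Sum>j<N. \<Sum>i<j. \<bar>x i \<bullet> x j\<bar>)"
    using lower upper eq by linarith
  have term_eq_less: "2 * (Q i j * (x i \<bullet> x j)) = \<bar>x i \<bullet> x j\<bar>" if "i < j" "j < N" for i j
  proof -
    have "(\<Sum>i<j. 2 * (Q i j * (x i \<bullet> x j))) = (\<Sum>i<j. \<bar>x i \<bullet> x j\<bar>)"
      by (rule sum_mono_inv[OF sums_eq inner_le]) (use that in auto)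
    then show ?thesis
      by (rule sum_mono_inv[OF _ le]) (use that in auto)
  qed
  have Q_half: "\<bar>Q i j\<bar> = 1/2" if "i < N" "j < N" "i \<noteq> j" "x i \<bullet> x j \<noteq> 0" for i j
  proof -
    have "2 * (Q i j * (x i \<bullet> x j)) = \<bar>x i \<bullet> x j\<bar>"
      using that term_eq_less[of i j] term_eq_less[of j i] sym[of i j]
      by (cases "i < j") (auto simp: inner_commute)
    then have "2 * (\<bar>Q i j\<bar> * \<bar>x i \<bullet> x j\<bar>) = \<bar>x i \<bullet> x j\<bar>"
      by (metis abs_idempotent abs_mult abs_numeral)
    then show ?thesis
      using that(4) by simp
  qed
  note Qij = Q_half[OF ij nz]
  have Qii: "Q i i = 1/2" and Qik: "\<And>k. k < N \<Longrightarrow> k \<noteq> i \<Longrightarrow> k \<noteq> j \<Longrightarrow> Q i k = 0"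
    using row[OF _ _ ij(3) Qij] ij by simp_all
  have "x i = (\<Sum>k\<in>{i, j}. Q i k *\<^sub>R x k)"
    unfolding Qx[OF ij(1), symmetric] using ij Qik
    by (intro sum.mono_neutral_right) auto
  then have half_sum: "x i = (1/2) *\<^sub>R x i + Q i j *\<^sub>R x j"
    using ij Qii by simp
  have "(1/2) *\<^sub>R x i + (1/2) *\<^sub>R x i = x i"
    by (simp flip: scaleR_add_left)
  with half_sum have "(1/2) *\<^sub>R x i = Q i j *\<^sub>R x j"
    by (metis add_left_cancel)
  then have "2 *\<^sub>R (1/2) *\<^sub>R x i = 2 *\<^sub>R Q i j *\<^sub>R x j"
    by simp
  then have "x i = (2 * Q i j) *\<^sub>R x j"
    by simp
  moreover have "2 * Q i j = 1 \<or> 2 * Q i j = -1"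
    using Qij by linarith
  ultimately have "x i = x j \<or> x i = - x j"
    by (metis scaleR_one scaleR_minus1_left)
  moreover have "x i \<bullet> x k = 0" if "k < N" "k \<noteq> i" "k \<noteq> j" for k
    using Q_half[of i k] Qik[of k] that ij by fastforce
  ultimately show "(x i = x j \<or> x i = - x j) \<and> (\<forall>k<N. k \<noteq> i \<longrightarrow> k \<noteq> j \<longrightarrow> x i \<bullet> x k = 0)"
    by blast
qed

section \<open>Lines and their unit vectors\<close>

lemma is_lineE_unit:
  assumes "is_line (l :: 'a::euclidean_space set)"
  obtains x where "norm x = 1" "l = span {x}"
proof -
  obtain B where B: "B \<subseteq> l" "independent B" "l \<subseteq> span B" "card B = dim l"
    using basis_exists[of l] by metis
  then obtain b where b: "B = {b}"
    using assms card_1_singletonE[of B] unfolding is_line_def by auto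
  then have "b \<noteq> 0"
    using B dependent_zero by blast
  have "span {b} = l"
    using B b assms unfolding is_line_def by (metis span_minimal subset_antisym)
  moreover have "span {sgn b} = span {b}"
    using \<open>b \<noteq> 0\<close> span_image_scale[of "{b}" "\<lambda>b. inverse (norm b)"] by (simp add: sgn_div_norm)
  ultimately show thesis
    using that[of "sgn b"] \<open>b \<noteq> 0\<close> by (simp add: norm_sgn)
qed

lemma is_line_span_singleton: "x \<noteq> 0 \<Longrightarrow> is_line (span {x :: 'a::euclidean_space})"
  by (simp add: is_line_def dim_eq_card_independent)

lemma line_familyE_unit:
  assumes "line_family N (L :: nat \<Rightarrow> 'a::euclidean_space set)"
  obtains x where "\<And>j. j < N \<Longrightarrow> norm (x j) = 1" "\<And>j. j < N \<Longrightarrow> L j = span {x j}"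
proof -
  have "\<forall>j\<in>{..<N}. \<exists>x. norm x = 1 \<and> L j = span {x}"
    using assms unfolding line_family_def by (meson is_lineE_unit lessThan_iff)
  then obtain x where "\<forall>j\<in>{..<N}. norm (x j) = 1 \<and> L j = span {x j}"
    by (rule bchoice[elim_format]) blast
  then show thesis
    by (intro that[of x]) auto
qed

lemma cos_angle_sum_span:
  fixes x :: "nat \<Rightarrow> 'a::euclidean_space"
  assumes "\<And>j. j < N \<Longrightarrow> norm (x j) = 1" "\<And>j. j < N \<Longrightarrow> L j = span {x j}"
  shows "cos_angle_sum N L = (\<Sum>j<N. \<Sum>i<j. \<bar>x i \<bullet> x j\<bar>)"
  unfolding cos_angle_sum_def using assms by (intro sum.cong) (auto simp: cos_line_angle_span)

lemma cos_angle_sum_ge: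
  fixes L :: "nat \<Rightarrow> 'a::euclidean_space set"
  assumes "line_family N L"
  shows "real N - DIM('a) \<le> cos_angle_sum N L"
proof -
  obtain x where x: "\<And>j. j < N \<Longrightarrow> norm (x j) = 1" "\<And>j. j < N \<Longrightarrow> L j = span {x j}"
    using line_familyE_unit[OF assms] by metis
  show ?thesis
    using abs_inner_sum_bound(1)[OF x(1)] by (simp add: cos_angle_sum_span[OF x])
qed

section \<open>Orthonormal bases\<close>

lemma orthonormal_basisI:
  fixes e :: "nat \<Rightarrow> 'a::euclidean_space"
  assumes "\<And>i j. i < DIM('a) \<Longrightarrow> j < DIM('a) \<Longrightarrow> e i \<bullet> e j = (if i = j then 1 else 0)"
  shows "orthonormal_basis e"
proof -
  have "inj_on e {..<DIM('a)}"
  proof (rule inj_onI)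
    fix i j assume "i \<in> {..<DIM('a)}" "j \<in> {..<DIM('a)}" "e i = e j"
    then show "i = j"
      using assms[of i j] assms[of j j] by (auto split: if_splits)
  qed
  then have "card (e ` {..<DIM('a)}) = DIM('a)"
    by (simp add: card_image)
  moreover have "independent (e ` {..<DIM('a)})"
  proof (rule pairwise_orthogonal_independent)
    show "pairwise orthogonal (e ` {..<DIM('a)})"
      using assms by (auto simp: pairwise_def orthogonal_def)
    show "0 \<notin> e ` {..<DIM('a)}"
      using assms by fastforce
  qed
  ultimately have "span (e ` {..<DIM('a)}) = UNIV"
    using card_ge_dim_independent[of "e ` {..<DIM('a)}" UNIV] by auto
  then show ?thesis
    using assms by (simp add: orthonormal_basis_def)
qed

lemma exists_orthonormal_basis:
  obtains e :: "nat \<Rightarrow> 'a::euclidean_space" where "orthonormal_basis e"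
proof -
  obtain e :: "nat \<Rightarrow> 'a::euclidean_space" where e: "bij_betw e {0..<DIM('a)} Basis"
    using ex_bij_betw_nat_finite[OF finite_Basis] by blast
  have "orthonormal_basis e"
  proof (rule orthonormal_basisI)
    fix i j assume ij: "i < DIM('a)" "j < DIM('a)"
    then have "e i \<in> Basis" "e j \<in> Basis" "e i = e j \<longleftrightarrow> i = j"
      using e bij_betwE[OF e] unfolding bij_betw_def inj_on_def by auto
    then show "e i \<bullet> e j = (if i = j then 1 else 0)"
      by (simp add: inner_Basis)
  qed
  then show thesis
    by (rule that)
qed

lemma orthonormal_basis_sum_inner:
  fixes e :: "nat \<Rightarrow> 'a::euclidean_space"
  assumes "orthonormal_basis e"
  shows "(\<Sum>k<DIM('a). (v \<bullet> e k) *\<^sub>R e k) = v"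
proof -
  have orth: "e i \<bullet> e j = (if i = j then 1 else 0)" if "i < DIM('a)" "j < DIM('a)" for i j
    using assms that unfolding orthonormal_basis_def by blast
  have span: "span (e ` {..<DIM('a)}) = UNIV"
    using assms unfolding orthonormal_basis_def by blast
  have "(\<Sum>k<DIM('a). (v \<bullet> e k) *\<^sub>R e k) \<bullet> e j = v \<bullet> e j" if "j < DIM('a)" for j
  proof -
    have "(\<Sum>k<DIM('a). (v \<bullet> e k) *\<^sub>R e k) \<bullet> e j = (\<Sum>k<DIM('a). if k = j then v \<bullet> e j else 0)"
      unfolding inner_sum_left using that by (intro sum.cong) (auto simp: orth)
    then show ?thesis using that by simp
  qed
  then show ?thesis
    by (intro vector_eq_dot_span[of _ "e ` {..<DIM('a)}"]) (auto simp: span inner_commute)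
qed

text \<open>
  The transformation keeps the coordinates of a vector and replaces the basis; by the expansion in
  the orthonormal basis \<open>e\<close> it preserves inner products.
\<close>

lemma orthonormal_basis_transformation:
  fixes e e' :: "nat \<Rightarrow> 'a::euclidean_space"
  assumes e: "orthonormal_basis e" and e': "orthonormal_basis e'"
  obtains f where "orthogonal_transformation f" "\<And>k. k < DIM('a) \<Longrightarrow> f (e k) = e' k"
proof -
  define f where "f v = (\<Sum>k<DIM('a). (v \<bullet> e k) *\<^sub>R e' k)" for v
  have orth: "e i \<bullet> e j = (if i = j then 1 else 0)" "e' i \<bullet> e' j = (if i = j then 1 else 0)"
    if "i < DIM('a)" "j < DIM('a)" for i j
    using e e' that unfolding orthonormal_basis_def by blast+
  have "linear f"
    unfolding f_def by (rule linearI)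
      (simp_all add: inner_add_left scaleR_add_left sum.distrib scaleR_sum_right)
  moreover have "f v \<bullet> f w = v \<bullet> w" for v w
  proof -
    have coeff: "e' k \<bullet> f w = e k \<bullet> w" if "k < DIM('a)" for k
    proof -
      have "e' k \<bullet> f w = (\<Sum>j<DIM('a). if j = k then w \<bullet> e k else 0)"
        unfolding f_def inner_sum_right using that by (intro sum.cong) (auto simp: orth)
      then show ?thesis using that by (simp add: inner_commute)
    qed
    have "f v \<bullet> f w = (\<Sum>k<DIM('a). (v \<bullet> e k) * (e' k \<bullet> f w))"
      by (subst (1) f_def) (simp add: inner_sum_left)
    also have "\<dots> = (\<Sum>k<DIM('a). (v \<bullet> e k) *\<^sub>R e k) \<bullet> w"
      by (simp add: coeff inner_sum_left)
    finally show ?thesis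
      by (simp add: orthonormal_basis_sum_inner[OF e])
  qed
  ultimately have "orthogonal_transformation f"
    by (simp add: orthogonal_transformation_def)
  moreover have "f (e k) = e' k" if "k < DIM('a)" for k
  proof -
    have "f (e k) = (\<Sum>j<DIM('a). if j = k then e' k else 0)"
      unfolding f_def using that by (intro sum.cong) (auto simp: orth)
    then show ?thesis using that by simp
  qed
  ultimately show thesis
    using that by blast
qed

section \<open>Repeated orthonormal bases\<close>

lemma repeated_orthonormal_basis_same_up_to_orthogonal:
  fixes L M :: "nat \<Rightarrow> 'a::euclidean_space set"
  assumes "repeated_orthonormal_basis N L" "repeated_orthonormal_basis N M"
  shows "same_up_to_orthogonal N L M"
proof -
  obtain e p where e: "orthonormal_basis e" and p: "p permutes {..<N}"
    and L: "\<And>j. j < N \<Longrightarrow> L (p j) = span {e (j mod DIM('a))}"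
    using assms(1) unfolding repeated_orthonormal_basis_def by blast
  obtain e' p' where e': "orthonormal_basis e'" and p': "p' permutes {..<N}"
    and M: "\<And>j. j < N \<Longrightarrow> M (p' j) = span {e' (j mod DIM('a))}"
    using assms(2) unfolding repeated_orthonormal_basis_def by blast
  obtain f where f: "orthogonal_transformation f" "\<And>k. k < DIM('a) \<Longrightarrow> f (e k) = e' k"
    using orthonormal_basis_transformation[OF e e'] by blast
  have "M ((p' \<circ> inv p) j) = f ` L j" if "j < N" for j
  proof -
    define k where "k = inv p j"
    have k: "k < N" "p k = j"
      using that permutes_in_image[OF permutes_inv[OF p], of j] permutes_inverses(1)[OF p]
      by (simp_all add: k_def)
    have "f ` span {e (k mod DIM('a))} = span {e' (k mod DIM('a))}"
      using f orthogonal_transformation_linear[OF f(1)] by (simp add: linear_span_image[symmetric])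
    then show ?thesis
      using L[OF k(1)] M[OF k(1)] k(2) by (simp add: k_def)
  qed
  then show ?thesis
    unfolding same_up_to_orthogonal_def
    using f(1) permutes_compose[OF permutes_inv[OF p] p'] by blast
qed

lemma repeated_orthonormal_basis_line_family:
  fixes L :: "nat \<Rightarrow> 'a::euclidean_space set"
  assumes "repeated_orthonormal_basis N L"
  shows "line_family N L"
proof -
  obtain e p where e: "orthonormal_basis e" and p: "p permutes {..<N}"
    and L: "\<And>j. j < N \<Longrightarrow> L (p j) = span {e (j mod DIM('a))}"
    using assms unfolding repeated_orthonormal_basis_def by blast
  have "is_line (L j)" if "j < N" for j
  proof -
    define k where "k = inv p j"
    have k: "k < N" "p k = j"
      using that permutes_in_image[OF permutes_inv[OF p], of j] permutes_inverses(1)[OF p]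
      by (simp_all add: k_def)
    have "e (k mod DIM('a)) \<noteq> 0"
      using e unfolding orthonormal_basis_def by (metis DIM_positive inner_zero_left mod_less_divisor zero_neq_one)
    then show ?thesis
      using L[OF k(1)] k(2) is_line_span_singleton by simp
  qed
  then show ?thesis
    by (simp add: line_family_def)
qed

text \<open>
  The sum runs over pairs \<open>i < j\<close>, an order that a permutation does not respect; the symmetric sum
  over all ordered pairs is invariant, and determines the sum over \<open>i < j\<close>.
\<close>

lemma cos_angle_sum_permute:
  fixes L :: "nat \<Rightarrow> 'a::euclidean_space set"
  assumes L: "line_family N L" and p: "p permutes {..<N}"
  shows "cos_angle_sum N (\<lambda>j. L (p j)) = cos_angle_sum N L"
proof -
  obtain x where x: "\<And>j. j < N \<Longrightarrow> norm (x j) = 1" "\<And>j. j < N \<Longrightarrow> L j = span {x j}"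
    using line_familyE_unit[OF L] by metis
  have pN: "p j < N" if "j < N" for j
    using permutes_in_image[OF p, of j] that by simp
  have double: "2 * (\<Sum>j<N. \<Sum>i<j. \<bar>y i \<bullet> y j\<bar>) = (\<Sum>i<N. \<Sum>j<N. \<bar>y i \<bullet> y j\<bar>) - real N"
    if "\<And>j. j < N \<Longrightarrow> norm (y j) = 1" for y :: "nat \<Rightarrow> 'a"
    using that by (subst sum_symmetric_eq_pairs) (auto simp: inner_commute norm_eq_1)
  have "(\<Sum>i<N. \<Sum>j<N. \<bar>x (p i) \<bullet> x (p j)\<bar>) = (\<Sum>i<N. \<Sum>j<N. \<bar>x i \<bullet> x j\<bar>)"
    using sum.reindex_bij_betw[OF permutes_imp_bij[OF p], of "\<lambda>i. \<Sum>j<N. \<bar>x i \<bullet> x j\<bar>"]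
      sum.reindex_bij_betw[OF permutes_imp_bij[OF p], of "\<lambda>j. \<bar>x (p i) \<bullet> x j\<bar>" for i]
    by simp
  then have "(\<Sum>j<N. \<Sum>i<j. \<bar>x (p i) \<bullet> x (p j)\<bar>) = (\<Sum>j<N. \<Sum>i<j. \<bar>x i \<bullet> x j\<bar>)"
    using double[of x] double[of "\<lambda>j. x (p j)"] x(1) pN by simp
  then show ?thesis
    using cos_angle_sum_span[OF x] cos_angle_sum_span[of N "\<lambda>j. x (p j)" "\<lambda>j. L (p j)"] x pN by simp
qed

text \<open>
  After the permutation, the line \<open>j \<ge> DIM('a)\<close> coincides with exactly one earlier line,
  \<open>j - DIM('a)\<close>, and all other pairs are orthogonal. The bound \<open>N \<le> 2 * DIM('a)\<close> is what excludes a
  third copy.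
\<close>

lemma cos_angle_sum_repeated_orthonormal_basis:
  fixes L :: "nat \<Rightarrow> 'a::euclidean_space set"
  assumes rep: "repeated_orthonormal_basis N L" and N: "DIM('a) \<le> N" "N \<le> 2 * DIM('a)"
  shows "cos_angle_sum N L = real N - DIM('a)"
proof -
  obtain e p where e: "orthonormal_basis e" and p: "p permutes {..<N}"
    and L: "\<And>j. j < N \<Longrightarrow> L (p j) = span {e (j mod DIM('a))}"
    using rep unfolding repeated_orthonormal_basis_def by blast
  have inner: "e (i mod DIM('a)) \<bullet> e (j mod DIM('a)) = (if i mod DIM('a) = j mod DIM('a) then 1 else 0)" for i j
    using e unfolding orthonormal_basis_def by simp
  have mod_eq: "k mod DIM('a) = (if k < DIM('a) then k else k - DIM('a))" if "k < N" for k
    using that N by (simp add: le_mod_geq)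
  have row: "(\<Sum>i<j. \<bar>e (i mod DIM('a)) \<bullet> e (j mod DIM('a))\<bar>) = (if DIM('a) \<le> j then 1 else 0)"
    if "j < N" for j
  proof (cases "DIM('a) \<le> j")
    case True
    then have j_mod: "j mod DIM('a) = j - DIM('a)"
      using that by (simp add: mod_eq)
    have "i mod DIM('a) = j mod DIM('a) \<longleftrightarrow> i = j - DIM('a)" if "i < j" for i
      using \<open>j < N\<close> that N True by (auto simp: mod_eq)
    then have "(\<Sum>i<j. \<bar>e (i mod DIM('a)) \<bullet> e (j mod DIM('a))\<bar>) = (\<Sum>i<j. if i = j - DIM('a) then 1 else 0)"
      by (intro sum.cong) (auto simp: inner)
    then show ?thesis
      using True DIM_positive[where 'a='a] by simp
  next
    case False
    then have "e (i mod DIM('a)) \<bullet> e (j mod DIM('a)) = 0" if "i < j" for i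
      using that inner[of i j] by simp
    then show ?thesis
      using False by simp
  qed
  have "cos_angle_sum N L = cos_angle_sum N (\<lambda>j. L (p j))"
    using cos_angle_sum_permute[OF repeated_orthonormal_basis_line_family[OF rep] p] by simp
  also have "\<dots> = (\<Sum>j<N. \<Sum>i<j. \<bar>e (i mod DIM('a)) \<bullet> e (j mod DIM('a))\<bar>)"
    using L inner by (intro cos_angle_sum_span) (auto simp: norm_eq_1)
  also have "\<dots> = (\<Sum>j<N. if DIM('a) \<le> j then 1 else 0)"
    by (intro sum.cong) (simp_all add: row)
  also have "\<dots> = real (card {DIM('a)..<N})"
  proof -
    have "{..<N} \<inter> Collect ((\<le>) DIM('a)) = {DIM('a)..<N}"
      by auto
    then show ?thesis
      by (simp add: sum.If_cases)
  qed
  finally show ?thesis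
    using N by (simp add: of_nat_diff)
qed

section \<open>Families attaining the bound\<close>

text \<open>
  The set \<open>B\<close> consists of second copies, and \<open>\<pi>\<close> sends a second copy to the first copy of the same
  line. The definition of a repeated orthonormal basis puts second copies at the positions
  \<open>DIM('a), \<dots>, N - 1\<close> and their first copies, in the same order, at \<open>0, \<dots>, N - DIM('a) - 1\<close>. So the
  enumeration \<open>q\<close> of \<open>B\<close> determines the first positions by \<open>\<pi> \<circ> q\<close>, and the unpaired lines fill
  the remaining positions below \<open>DIM('a)\<close>.
\<close>

lemma repeated_orthonormal_basisI_matching:
  fixes x :: "nat \<Rightarrow> 'a::euclidean_space"
  assumes N: "DIM('a) \<le> N" "N \<le> 2 * DIM('a)"
    and L: "\<And>i. i < N \<Longrightarrow> L i = span {x i}"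
    and A: "A = {..<N} - B" "B \<subseteq> {..<N}" "card B = N - DIM('a)"
    and orth: "\<And>i j. i \<in> A \<Longrightarrow> j \<in> A \<Longrightarrow> x i \<bullet> x j = (if i = j then 1 else 0)"
    and \<pi>: "inj_on \<pi> B" "\<pi> ` B \<subseteq> A" "\<And>j. j \<in> B \<Longrightarrow> span {x (\<pi> j)} = span {x j}"
  shows "repeated_orthonormal_basis N L"
proof -
  let ?d = "DIM('a)"
  have fin: "finite A" "finite B"
    using A finite_subset[of B "{..<N}"] by auto
  have card_A: "card A = ?d"
    using A N fin by (simp add: card_Diff_subset)
  obtain q where q: "bij_betw q {..<N - ?d} B"
    using finite_same_card_bij[of "{..<N - ?d}" B] A fin by auto
  have "card (A - \<pi> ` B) = card {N - ?d..<?d}"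
    using \<pi> fin card_A A N by (simp add: card_Diff_subset card_image)
  then obtain g where g: "bij_betw g {N - ?d..<?d} (A - \<pi> ` B)"
    using finite_same_card_bij[of "{N - ?d..<?d}" "A - \<pi> ` B"] fin by auto
  define r where "r j = (if j \<in> {..<N - ?d} then (\<pi> \<circ> q) j else g j)" for j
  have r: "bij_betw r {..<?d} A"
  proof -
    have "bij_betw (\<pi> \<circ> q) {..<N - ?d} (\<pi> ` B)"
      using q \<pi>(1) by (auto intro: bij_betw_trans simp: bij_betw_imageI)
    then have "bij_betw r ({..<N - ?d} \<union> {N - ?d..<?d}) (\<pi> ` B \<union> (A - \<pi> ` B))"
      unfolding r_def using g by (rule bij_betw_disjoint_Un) auto
    moreover have "{..<N - ?d} \<union> {N - ?d..<?d} = {..<?d}" "\<pi> ` B \<union> (A - \<pi> ` B) = A"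
      using N \<pi>(2) by auto
    ultimately show ?thesis by simp
  qed
  define p where "p j = (if j \<in> {..<?d} then r j else if j < N then q (j - ?d) else j)" for j
  have p: "p permutes {..<N}"
  proof (rule bij_imp_permutes)
    have "bij_betw (\<lambda>j. j - ?d) {?d..<N} {..<N - ?d}"
      by (rule bij_betw_byWitness[of _ "\<lambda>j. j + ?d"]) (use N in auto)
    then have "bij_betw (q \<circ> (\<lambda>j. j - ?d)) {?d..<N} B"
      using q by (rule bij_betw_trans)
    then have "bij_betw (\<lambda>j. if j < N then q (j - ?d) else j) {?d..<N} B"
      by (rule bij_betw_cong[THEN iffD1, rotated]) simp
    then have "bij_betw p ({..<?d} \<union> {?d..<N}) (A \<union> B)"
      unfolding p_def using r A by (intro bij_betw_disjoint_Un) auto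
    moreover have "{..<?d} \<union> {?d..<N} = {..<N}" "A \<union> B = {..<N}"
      using N A by auto
    ultimately show "bij_betw p {..<N} {..<N}" by simp
    show "p j = j" if "j \<notin> {..<N}" for j
      using that N by (simp add: p_def)
  qed
  have "orthonormal_basis (x \<circ> r)"
  proof (rule orthonormal_basisI)
    fix i j assume "i < ?d" "j < ?d"
    moreover from this have "r i \<in> A" "r j \<in> A" "r i = r j \<longleftrightarrow> i = j"
      using r bij_betwE[OF r] unfolding bij_betw_def inj_on_def by auto
    ultimately show "(x \<circ> r) i \<bullet> (x \<circ> r) j = (if i = j then 1 else 0)"
      by (simp add: orth)
  qed
  moreover have "L (p j) = span {(x \<circ> r) (j mod ?d)}" if "j < N" for j
  proof -
    have pN: "p j < N"
      using permutes_in_image[OF p, of j] that by simp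
    show ?thesis
    proof (cases "j < ?d")
      case True
      then show ?thesis
        using L[OF pN] by (simp add: p_def)
    next
      case False
      then have j_mod: "j mod ?d = j - ?d" and less: "j - ?d < N - ?d"
        using that N by (simp_all add: le_mod_geq)
      have "p j = q (j - ?d)" "r (j - ?d) = \<pi> (q (j - ?d))" "q (j - ?d) \<in> B"
        using False that less bij_betwE[OF q] by (auto simp: p_def r_def)
      then show ?thesis
        using L[OF pN] \<pi>(3)[of "q (j - ?d)"] by (simp add: j_mod)
    qed
  qed
  ultimately show ?thesis
    unfolding repeated_orthonormal_basis_def using p by blast
qed

text \<open>
  Non-orthogonal pairs form a matching of coinciding lines, by \<open>abs_inner_sum_bound\<close>. Every pair of
  the matching contributes one to the sum of cosines and all other pairs contribute nothing, so the
  matching has exactly \<open>N - DIM('a)\<close> pairs; the remaining \<open>DIM('a)\<close> lines are mutually orthogonal.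
\<close>

lemma repeated_orthonormal_basis_of_cos_angle_sum_eq:
  fixes L :: "nat \<Rightarrow> 'a::euclidean_space set"
  assumes N: "DIM('a) \<le> N" "N \<le> 2 * DIM('a)"
    and fam: "line_family N L" and eq: "cos_angle_sum N L = real N - DIM('a)"
  shows "repeated_orthonormal_basis N L"
proof -
  obtain x where unit: "\<And>j. j < N \<Longrightarrow> norm (x j) = 1" and L: "\<And>j. j < N \<Longrightarrow> L j = span {x j}"
    using line_familyE_unit[OF fam] by metis
  have sum_eq: "(\<Sum>j<N. \<Sum>i<j. \<bar>x i \<bullet> x j\<bar>) = real N - DIM('a)"
    using eq by (simp add: cos_angle_sum_span[OF unit L])
  have parallel: "x i = x j \<or> x i = - x j" and lonely: "\<And>k. k < N \<Longrightarrow> k \<noteq> i \<Longrightarrow> k \<noteq> j \<Longrightarrow> x i \<bullet> x k = 0"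
    if "i < N" "j < N" "i \<noteq> j" "x i \<bullet> x j \<noteq> 0" for i j
    using abs_inner_sum_bound(2)[OF unit sum_eq that] by auto
  \<comment> \<open>A line is a second copy if an earlier line is not orthogonal to it.\<close>
  define B where "B = {j. j < N \<and> (\<exists>i<j. x i \<bullet> x j \<noteq> 0)}"
  define A where "A = {..<N} - B"
  obtain \<pi> where \<pi>: "\<And>j. j \<in> B \<Longrightarrow> \<pi> j < j \<and> x (\<pi> j) \<bullet> x j \<noteq> 0"
    using bchoice[of B "\<lambda>j i. i < j \<and> x i \<bullet> x j \<noteq> 0"] unfolding B_def by blast
  have B_less: "j < N" if "j \<in> B" for j
    using that by (simp add: B_def)
  have row: "(\<Sum>i<j. \<bar>x i \<bullet> x j\<bar>) = (if j \<in> B then 1 else 0)" if "j < N" for j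
  proof (cases "j \<in> B")
    case True
    note \<pi>j = \<pi>[OF True]
    have "\<bar>x i \<bullet> x j\<bar> = (if i = \<pi> j then 1 else 0)" if "i < j" for i
      using lonely[of j "\<pi> j" i] parallel[of "\<pi> j" j] unit[OF \<open>j < N\<close>] \<pi>j that \<open>j < N\<close>
      by (auto simp: inner_commute norm_eq_1)
    then have "(\<Sum>i<j. \<bar>x i \<bullet> x j\<bar>) = (\<Sum>i<j. if i = \<pi> j then 1 else 0)"
      by (intro sum.cong) auto
    then show ?thesis
      using True \<pi>j by simp
  next
    case False
    then show ?thesis
      using that by (auto simp: B_def)
  qed
  have "real (card B) = (\<Sum>j<N. if j \<in> B then 1 else 0)"
  proof -
    have "{..<N} \<inter> B = B"
      using B_less by auto
    then show ?thesis
      by (simp add: sum.If_cases)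
  qed
  also have "\<dots> = real N - DIM('a)"
    using sum_eq row by simp
  finally have card_B: "card B = N - DIM('a)"
    using N by linarith
  show ?thesis
  proof (rule repeated_orthonormal_basisI_matching[OF N L A_def _ card_B])
    show "B \<subseteq> {..<N}"
      using B_less by auto
    show "x i \<bullet> x j = (if i = j then 1 else 0)" if "i \<in> A" "j \<in> A" for i j
      using that unit[of i] unfolding A_def B_def
      by (cases i j rule: linorder_cases) (auto simp: norm_eq_1 inner_commute)
    show "inj_on \<pi> B"
    proof (rule inj_onI, rule ccontr)
      fix j k assume jk: "j \<in> B" "k \<in> B" "\<pi> j = \<pi> k" "j \<noteq> k"
      then show False
        using \<pi>[of j] \<pi>[of k] lonely[of "\<pi> j" j k] B_less[of j] B_less[of k] by auto
    qed
    show "\<pi> ` B \<subseteq> A"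
    proof
      fix i assume "i \<in> \<pi> ` B"
      then obtain j where j: "j \<in> B" "i = \<pi> j" by blast
      \<comment> \<open>The only line not orthogonal to \<open>L i\<close> is its partner \<open>L j\<close>, which comes later.\<close>
      then have "x i \<bullet> x k = 0" if "k < i" for k
        using \<pi>[of j] lonely[of i j k] B_less[of j] that by auto
      then show "i \<in> A"
        using j \<pi>[of j] B_less[of j] by (auto simp: A_def B_def inner_commute)
    qed
    show "span {x (\<pi> j)} = span {x j}" if "j \<in> B" for j
    proof -
      have "span {- x j} = span {x j}"
        using span_image_scale[of "{x j}" "\<lambda>_. -1"] by simp
      moreover have "x (\<pi> j) = x j \<or> x (\<pi> j) = - x j"
        using parallel[of "\<pi> j" j] \<pi>[OF that] B_less[OF that] by linarith
      ultimately show ?thesis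
        by metis
    qed
  qed
qed

section \<open>The minimum and the minimizers\<close>

theorem corollary3p1:
  fixes N :: nat
  shows "(\<forall>L :: nat \<Rightarrow> (real ^ 'd) set. line_family N L \<longrightarrow>
            cos_angle_sum N L \<ge> real N - real CARD('d)) \<and>
         (CARD('d) \<le> N \<and> N \<le> 2 * CARD('d) \<longrightarrow>
            (\<exists>L :: nat \<Rightarrow> (real ^ 'd) set. line_family N L \<and>
               cos_angle_sum N L = real N - real CARD('d)) \<and>
            (\<forall>L :: nat \<Rightarrow> (real ^ 'd) set.
               is_arg_min (cos_angle_sum N) (line_family N) L \<longleftrightarrow> repeated_orthonormal_basis N L) \<and>
            (\<forall>(L :: nat \<Rightarrow> (real ^ 'd) set) M.
               is_arg_min (cos_angle_sum N) (line_family N) L \<and>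
               is_arg_min (cos_angle_sum N) (line_family N) M \<longrightarrow> same_up_to_orthogonal N L M))"
proof -
  have lower: "real N - real CARD('d) \<le> cos_angle_sum N L"
    if "line_family N L" for L :: "nat \<Rightarrow> (real ^ 'd) set"
    using cos_angle_sum_ge[OF that] by simp
  {
    assume N: "CARD('d) \<le> N" "N \<le> 2 * CARD('d)"
    obtain e :: "nat \<Rightarrow> real ^ 'd" where "orthonormal_basis e"
      using exists_orthonormal_basis by blast
    then have rep: "repeated_orthonormal_basis N (\<lambda>j. span {e (j mod CARD('d))})"
      unfolding repeated_orthonormal_basis_def
      by (intro exI[of _ e] exI[of _ id]) (simp add: permutes_id[unfolded id_def] id_def)
    have attained: "line_family N L \<and> cos_angle_sum N L = real N - real CARD('d)"
      if "repeated_orthonormal_basis N L" for L :: "nat \<Rightarrow> (real ^ 'd) set"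
      using repeated_orthonormal_basis_line_family[OF that]
        cos_angle_sum_repeated_orthonormal_basis[OF that] N by simp
    have arg_min: "is_arg_min (cos_angle_sum N) (line_family N) L \<longleftrightarrow> repeated_orthonormal_basis N L"
      for L :: "nat \<Rightarrow> (real ^ 'd) set"
    proof
      assume min: "is_arg_min (cos_angle_sum N) (line_family N) L"
      then have fam: "line_family N L"
        by (simp add: is_arg_min_def)
      have "cos_angle_sum N L \<le> real N - real CARD('d)"
        using min attained[OF rep] unfolding is_arg_min_def by (metis not_le)
      then have "cos_angle_sum N L = real N - DIM(real ^ 'd)"
        using lower[OF fam] by simp
      then show "repeated_orthonormal_basis N L"
        using N fam by (intro repeated_orthonormal_basis_of_cos_angle_sum_eq) simp_all
    next
      assume "repeated_orthonormal_basis N L"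
      then show "is_arg_min (cos_angle_sum N) (line_family N) L"
        using attained lower unfolding is_arg_min_def by fastforce
    qed
    have "(\<exists>L :: nat \<Rightarrow> (real ^ 'd) set. line_family N L \<and>
               cos_angle_sum N L = real N - real CARD('d)) \<and>
            (\<forall>L :: nat \<Rightarrow> (real ^ 'd) set.
               is_arg_min (cos_angle_sum N) (line_family N) L \<longleftrightarrow> repeated_orthonormal_basis N L) \<and>
            (\<forall>(L :: nat \<Rightarrow> (real ^ 'd) set) M.
               is_arg_min (cos_angle_sum N) (line_family N) L \<and>
               is_arg_min (cos_angle_sum N) (line_family N) M \<longrightarrow> same_up_to_orthogonal N L M)"
      using attained[OF rep] arg_min repeated_orthonormal_basis_same_up_to_orthogonal by blast
  }
  then show ?thesis
    using lower by blast
qed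

end
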